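(* For any symmetrizable generalized Cartan matrix $A=(a_{i,i'})_{i,i'\in[1,r]}$ and any signed word $\mathbf{i}^\dagger=(i_1^\dagger,\dots,i_n^\dagger)$ in $[1,r]$, the nondegenerate cluster ensemble matrix $\widehat B(\mathbf{i}^\dagger)$ satisfies $$\widehat B(\mathbf{i}^\dagger)=\widehat M(\mathbf{i}^\dagger)=E(\mathbf{i}^\dagger)^t\,Q(\mathbf{i}^\dagger)\,E(\mathbf{i}^\dagger).$$ In particular, $\det(\widehat B(\mathbf{i}^\dagger))=1$.
   Context: $[a,b]$ is the set of integers between $a$ and $b$. $e_1,\dots,e_n$ is the standard basis of column vectors, $e_{+\infty}:=0$. A permutation $\tau\in S_n$ also denotes the matrix with columns $e_{\tau(1)},\dots,e_{\tau(n)}$. A generalized Cartan matrix is an integer matrix with $a_{i,i}=2$, $a_{i,i'}\le0$ for $i\ne i'$, and $a_{i,i'}=0\iff a_{i',i}=0$; symmetrizable means there are positive integers $d_i$ with $d_ia_{i,i'}=d_{i'}a_{i',i}$. A signed word in $[1,r]$ is a sequence $\mathbf{i}^\dagger=(i_1^\dagger,\dots,i_n^\dagger)$ with $i_j^\dagger\in[-r,-1]\sqcup[1,r]$ ($n\ge2$); put $\varepsilon_j=\mathrm{sign}(i_j^\dagger)$. For $j\in[1,n]$, $j[1]=\min\{j'\in[j+1,n]:|i^\dagger_{j'}|=|i^\dagger_j|\}$ if this set is non-empty and $j[1]=+\infty$ otherwise. Nondegenerate cluster ensemble matrix. With $\{P\}$ equal to $1$ if the statement $P$ holds and $0$ otherwise,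 $\widehat B(\mathbf{i}^\dagger)$ is the $n\times n$ matrix with $(j,k)$-entry $$\tfrac12a_{|i_j^\dagger|,|i_k^\dagger|}\Big(\{j[1]=k[1]=+\infty\}+\varepsilon_k\{j[1]=k\}-\varepsilon_j\{k[1]=j\}+\varepsilon_k\{j<k<j[1]\}-\varepsilon_{k[1]}\{j<k[1]<j[1]\}\{k[1]<+\infty\}-\varepsilon_j\{k<j<k[1]\}+\varepsilon_{j[1]}\{k<j[1]<k[1]\}\{j[1]<+\infty\}\Big)$$ (terms with a factor $\{k[1]<+\infty\}=0$, resp. $\{j[1]<+\infty\}=0$, are $0$). For a double reduced word of a pair of Weyl group elements this matrix comes from H. Williams's computation of the monomial change of coordinates between the co-weight parametrization and the generalized Chamber Ansatz on double Bruhat cells; the formula extends the definition to arbitrary signed words. Matrix $\widehat M(\mathbf{i}^\dagger)$. Let $a_1<\dots<a_m$ be the positions of the positive entries of $\mathbf{i}^\dagger$ and $b_1<\dots<b_{n-m}$ those of the negative entries. Let $\mathbf{i}=(i_1,\dots,i_n)=(i^\dagger_{a_m},\dots,i^\dagger_{a_1},-i^\dagger_{b_1},\dots,-i^\dagger_{b_{n-m}})$ and let $\tau\in S_n$ be given by $\tau(a_t)=m+1-t$ for $t\in[1,m]$, $\tau(b_t)=m+t$ for $t\in[1,n-m]$. Let $s_\tau(j)=\min\{j'\in[j+1,n]:i_{\tau(j')}=i_{\tau(j)}\}$ ($+\infty$ if the set is empty), $E_\tau$ the $n\times n$ matrix with $j$-th column $e_j-e_{s_\tau(j)}$, and $Q$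 the upper triangular matrix with diagonal entries $1$ and $(j,k)$-entry $a_{i_j,i_k}$ for $j<k$. Then $\widehat M(\mathbf{i}^\dagger):=(\tau E_\tau)^tQ\,\tau E_\tau$. Matrices $E(\mathbf{i}^\dagger),Q(\mathbf{i}^\dagger)$. $E(\mathbf{i}^\dagger)$ is the $n\times n$ matrix with $j$-th column $e_j-e_{j[1]}$. Let $\mathcal{P}(\mathbf{i}^\dagger)$ be the set of pairs $(j,k)\in[1,n]^2$ such that: $\varepsilon_j=1$ and $\varepsilon_k=-1$; or $\varepsilon_j=\varepsilon_k=1$ and $j>k$; or $\varepsilon_j=\varepsilon_k=-1$ and $j<k$. $Q(\mathbf{i}^\dagger)$ is the $n\times n$ matrix with $(j,k)$-entry $1$ if $j=k$, $a_{|i_j^\dagger|,|i_k^\dagger|}$ if $(j,k)\in\mathcal{P}(\mathbf{i}^\dagger)$, and $0$ otherwise.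
   Formalization: Every sign ε in the bracket defining B̂ is replaced by −ε: as printed, for A=(2) and the word (−1,−1) the (1,2)-entry of B̂ is −1 while that of M̂ and of EᵗQE is +1. All other definitions and hypotheses are unchanged. *)

theory Defs
  imports "Jordan_Normal_Form.Determinant" "HOL-Library.Extended_Nat"
begin

text \<open>
  Indices and positions are 1-based, whereas \<open>mat\<close>, \<open>vec\<close> and lists
  are 0-based; the shift is confined to \<open>mat1\<close>, \<open>basis_vec\<close>, \<open>cols1\<close>,
  \<open>entry\<close> and \<open>letter\<close>.
  All matrices other than the Cartan matrix are rational, because of the factor \<open>1/2\<close>
  in \<open>B_hat\<close>.
\<close>

definition mat1 :: "nat \<Rightarrow> (nat \<Rightarrow> nat \<Rightarrow> rat) \<Rightarrow> rat mat" where
  "mat1 n f = mat n n (\<lambda>(j, k). f (j + 1) (k + 1))"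

text \<open>\<open>basis_vec n \<infinity>\<close> is the zero vector.\<close>

definition basis_vec :: "nat \<Rightarrow> enat \<Rightarrow> rat vec" where
  "basis_vec n x = vec n (\<lambda>i. if enat (i + 1) = x then 1 else 0)"

definition cols1 :: "nat \<Rightarrow> (nat \<Rightarrow> rat vec) \<Rightarrow> rat mat" where
  "cols1 n c = mat_of_cols n (map c [1..<n + 1])"

definition entry :: "int mat \<Rightarrow> nat \<Rightarrow> nat \<Rightarrow> int" where
  "entry A i k = A $$ (i - 1, k - 1)"

definition generalized_cartan :: "nat \<Rightarrow> int mat \<Rightarrow> bool" where
  "generalized_cartan r A \<longleftrightarrow> A \<in> carrier_mat r r \<and>
     (\<forall>i\<in>{1..r}. entry A i i = 2) \<and>
     (\<forall>i\<in>{1..r}. \<forall>k\<in>{1..r}. i \<noteq> k \<longrightarrow> entry A i k \<le> 0) \<and>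
     (\<forall>i\<in>{1..r}. \<forall>k\<in>{1..r}. entry A i k = 0 \<longleftrightarrow> entry A k i = 0)"

definition symmetrizable :: "nat \<Rightarrow> int mat \<Rightarrow> bool" where
  "symmetrizable r A \<longleftrightarrow>
     (\<exists>d :: nat \<Rightarrow> int. (\<forall>i\<in>{1..r}. 0 < d i) \<and>
        (\<forall>i\<in>{1..r}. \<forall>k\<in>{1..r}. d i * entry A i k = d k * entry A k i))"

definition signed_word :: "nat \<Rightarrow> int list \<Rightarrow> bool" where
  "signed_word r w \<longleftrightarrow> 2 \<le> length w \<and> set w \<subseteq> {- int r..-1} \<union> {1..int r}"

definition letter :: "int list \<Rightarrow> nat \<Rightarrow> int" where
  "letter w j = w ! (j - 1)"

definition eps :: "int list \<Rightarrow> nat \<Rightarrow> rat" where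
  "eps w j = of_int (sgn (letter w j))"

definition cartan :: "int mat \<Rightarrow> int \<Rightarrow> int \<Rightarrow> rat" where
  "cartan A i k = of_int (entry A (nat i) (nat k))"

definition next_occ :: "nat \<Rightarrow> (nat \<Rightarrow> int) \<Rightarrow> nat \<Rightarrow> enat" where
  "next_occ n f j =
     (let S = {j' \<in> {j + 1..n}. f j' = f j} in if S = {} then \<infinity> else enat (Min S))"

definition nxt :: "int list \<Rightarrow> nat \<Rightarrow> enat" where
  "nxt w = next_occ (length w) (\<lambda>j. \<bar>letter w j\<bar>)"

text \<open>
  The sign in the bracket of \<open>B_hat\<close> is \<open>- eps\<close>, not \<open>eps\<close>. Printed with \<open>eps\<close>, the
  formula contradicts the definitions of \<open>M_hat\<close>, \<open>E_mat\<close> and \<open>Q_mat\<close> below: for the Cartan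
  matrix \<open>(2)\<close> and the word \<open>[-1, -1]\<close> its entry in row 1, column 2 would be \<open>-1\<close>, whereas
  that of \<open>M_hat\<close> is \<open>1\<close>. Since \<open>eps\<close> is odd in the word and \<open>nxt\<close> depends only on the
  absolute values of the letters, \<open>B_hat A w\<close> is the formula with \<open>eps\<close> evaluated at
  \<open>map uminus w\<close>.
\<close>

definition eta :: "int list \<Rightarrow> nat \<Rightarrow> rat" where
  "eta w j = - eps w j"

text \<open>
  In the two terms containing \<open>the_enat\<close> the last factor vanishes when the argument
  is \<open>\<infinity>\<close>, so the value of \<open>the_enat \<infinity>\<close> plays no role.
\<close>

definition B_hat :: "int mat \<Rightarrow> int list \<Rightarrow> rat mat" where
  "B_hat A w = mat1 (length w) (\<lambda>j k.
     1 / 2 * cartan A \<bar>letter w j\<bar> \<bar>letter w k\<bar> *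
     (of_bool (nxt w j = \<infinity> \<and> nxt w k = \<infinity>)
      + eta w k * of_bool (nxt w j = enat k)
      - eta w j * of_bool (nxt w k = enat j)
      + eta w k * of_bool (j < k \<and> enat k < nxt w j)
      - eta w (the_enat (nxt w k)) *
          of_bool (enat j < nxt w k \<and> nxt w k < nxt w j) * of_bool (nxt w k < \<infinity>)
      - eta w j * of_bool (k < j \<and> enat j < nxt w k)
      + eta w (the_enat (nxt w j)) *
          of_bool (enat k < nxt w j \<and> nxt w j < nxt w k) * of_bool (nxt w j < \<infinity>)))"

definition pos_positions :: "int list \<Rightarrow> nat list" where
  "pos_positions w = filter (\<lambda>j. 0 < letter w j) [1..<length w + 1]"

definition neg_positions :: "int list \<Rightarrow> nat list" where
  "neg_positions w = filter (\<lambda>j. letter w j < 0) [1..<length w + 1]"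

definition unsigned_word :: "int list \<Rightarrow> int list" where
  "unsigned_word w =
     map (letter w) (rev (pos_positions w)) @ map (\<lambda>b. - letter w b) (neg_positions w)"

text \<open>
  \<open>index_in xs x\<close> is the \<open>t\<close> for which \<open>x\<close> is the \<open>t\<close>-th element (counted from 1) of the
  distinct list \<open>xs\<close>. Outside the set of positions, \<open>tau w\<close> is the identity, as is the
  convention for permutations of a subset.
\<close>

definition index_in :: "nat list \<Rightarrow> nat \<Rightarrow> nat" where
  "index_in xs x = (THE t. t \<in> {1..length xs} \<and> xs ! (t - 1) = x)"

definition tau :: "int list \<Rightarrow> nat \<Rightarrow> nat" where
  "tau w j =
     (let a = pos_positions w; b = neg_positions w; m = length a in
      if j \<in> set a then m + 1 - index_in a j
      else if j \<in> set b then m + index_in b j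
      else j)"

definition perm_mat :: "nat \<Rightarrow> (nat \<Rightarrow> nat) \<Rightarrow> rat mat" where
  "perm_mat n \<pi> = cols1 n (\<lambda>j. basis_vec n (enat (\<pi> j)))"

definition s_tau :: "int list \<Rightarrow> nat \<Rightarrow> enat" where
  "s_tau w = next_occ (length w) (\<lambda>j. letter (unsigned_word w) (tau w j))"

definition E_tau :: "int list \<Rightarrow> rat mat" where
  "E_tau w = cols1 (length w)
     (\<lambda>j. basis_vec (length w) (enat j) - basis_vec (length w) (s_tau w j))"

definition Q_upper :: "int mat \<Rightarrow> int list \<Rightarrow> rat mat" where
  "Q_upper A i = mat1 (length i) (\<lambda>j k.
     if j = k then 1 else if j < k then cartan A (letter i j) (letter i k) else 0)"

definition M_hat :: "int mat \<Rightarrow> int list \<Rightarrow> rat mat" where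
  "M_hat A w =
     (let T = perm_mat (length w) (tau w) * E_tau w
      in transpose_mat T * Q_upper A (unsigned_word w) * T)"

definition E_mat :: "int list \<Rightarrow> rat mat" where
  "E_mat w = cols1 (length w)
     (\<lambda>j. basis_vec (length w) (enat j) - basis_vec (length w) (nxt w j))"

definition P_set :: "int list \<Rightarrow> (nat \<times> nat) set" where
  "P_set w = {(j, k) \<in> {1..length w} \<times> {1..length w}.
     eps w j = 1 \<and> eps w k = -1 \<or>
     eps w j = 1 \<and> eps w k = 1 \<and> j > k \<or>
     eps w j = -1 \<and> eps w k = -1 \<and> j < k}"

definition Q_mat :: "int mat \<Rightarrow> int list \<Rightarrow> rat mat" where
  "Q_mat A w = mat1 (length w) (\<lambda>j k.
     if j = k then 1
     else if (j, k) \<in> P_set w then cartan A \<bar>letter w j\<bar> \<bar>letter w k\<bar>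
     else 0)"

end

theory Submission
  imports Defs
begin

text \<open>
  On the positions \<open>x\<close>, \<open>y\<close> carrying a fixed pair of letters, the entry \<open>(x, y)\<close> of \<open>Q_mat\<close> is the
  Cartan integer times \<open>(1 + {y < x} \<epsilon>\<^sub>x - {x < y} \<epsilon>\<^sub>y) / 2\<close>; the diagonal entry fits because the
  Cartan integer is then \<open>2\<close>. Conjugation by \<open>E_mat\<close> takes the mixed difference of these entries
  between \<open>j\<close> and \<open>j[1]\<close> and between \<open>k\<close> and \<open>k[1]\<close>, which is the bracket in \<open>B_hat\<close>. The
  permutation \<open>tau\<close> carries the letter of \<open>w\<close> at \<open>j\<close> to the letter of the unsigned word at
  \<open>tau w j\<close>, and it turns the relation \<open>P_set\<close> into \<open><\<close>, so that it conjugates \<open>Q_upper\<close> into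
  \<open>Q_mat\<close>. Everything in the product is unitriangular up to that permutation.
\<close>

section \<open>Matrices with indices starting from 1\<close>

lemma mat1_carrier [simp]: "mat1 n f \<in> carrier_mat n n"
  by (simp add: mat1_def)

lemma mat1_cong:
  assumes "\<And>j k. j \<in> {1..n} \<Longrightarrow> k \<in> {1..n} \<Longrightarrow> f j k = g j k"
  shows "mat1 n f = mat1 n g"
  unfolding mat1_def by (rule cong_mat) (auto intro: assms)

lemma transpose_mat1: "transpose_mat (mat1 n f) = mat1 n (\<lambda>j k. f k j)"
  unfolding mat1_def by (rule eq_matI) auto

lemma mult_mat1: "mat1 n f * mat1 n g = mat1 n (\<lambda>j k. \<Sum>l\<in>{1..n}. f j l * g l k)"
proof -
  have "(\<Sum>l<n. h (Suc l)) = (\<Sum>l\<in>{1..n}. h l)" for h :: "nat \<Rightarrow> rat"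
    by (rule sum.reindex_bij_witness[where i="\<lambda>l. l - 1" and j=Suc]) auto
  then show ?thesis
    unfolding mat1_def
    by (intro eq_matI) (auto simp: scalar_prod_def atLeast0LessThan)
qed

lemma cols1_eq_mat1: "cols1 n c = mat1 n (\<lambda>j k. c k $ (j - 1))"
  unfolding mat1_def cols1_def
  by (rule eq_matI) (auto simp: mat_of_cols_def nth_upt simp del: upt_Suc)

lemma perm_mat_eq_mat1: "perm_mat n p = mat1 n (\<lambda>j k. of_bool (j = p k))"
  unfolding perm_mat_def cols1_eq_mat1 by (rule mat1_cong) (auto simp: basis_vec_def)

lemma cols1_difference_eq_mat1:
  "cols1 n (\<lambda>j. basis_vec n (enat j) - basis_vec n (s j)) =
    mat1 n (\<lambda>j k. of_bool (j = k) - of_bool (enat j = s k))"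
  unfolding cols1_eq_mat1 by (rule mat1_cong) (auto simp: basis_vec_def)

lemma one_mat_eq_mat1: "1\<^sub>m n = mat1 n (\<lambda>j k. of_bool (j = k))"
  unfolding mat1_def by (rule eq_matI) auto

lemma det_mat1_upper:
  assumes "\<And>j. j \<in> {1..n} \<Longrightarrow> f j j = 1"
    and "\<And>j k. j \<in> {1..n} \<Longrightarrow> k \<in> {1..n} \<Longrightarrow> k < j \<Longrightarrow> f j k = 0"
  shows "det (mat1 n f) = 1"
proof -
  have "det (mat1 n f) = prod_list (diag_mat (mat1 n f))"
    by (rule det_upper_triangular[of _ n]) (auto simp: mat1_def assms)
  also have "diag_mat (mat1 n f) = replicate n 1"
    by (rule nth_equalityI) (auto simp: diag_mat_def mat1_def assms)
  finally show ?thesis by simp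
qed

section \<open>Conjugation by permutation matrices\<close>

lemma conj_perm_mat:
  assumes "\<And>j. j \<in> {1..n} \<Longrightarrow> p j \<in> {1..n}"
  shows "transpose_mat (perm_mat n p) * mat1 n f * perm_mat n p = mat1 n (\<lambda>j k. f (p j) (p k))"
  unfolding perm_mat_eq_mat1 transpose_mat1 mult_mat1
  by (rule mat1_cong) (use assms in \<open>auto simp: of_bool_def if_distrib if_distribR sum.delta cong: if_cong\<close>)

text \<open>The sign of the permutation never has to be computed: only the square of
  \<open>det ?P\<close> occurs, and conjugating the identity matrix shows that this square is
  1.\<close>

lemma det_conj_perm_mat:
  assumes "\<And>j. j \<in> {1..n} \<Longrightarrow> p j \<in> {1..n}" and "inj_on p {1..n}"
  shows "det (transpose_mat (perm_mat n p) * mat1 n f * perm_mat n p) = det (mat1 n f)"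
proof -
  let ?P = "perm_mat n p"
  have P: "?P \<in> carrier_mat n n"
    by (simp add: perm_mat_eq_mat1)
  have "transpose_mat ?P * mat1 n (\<lambda>j k. of_bool (j = k)) * ?P = 1\<^sub>m n"
    unfolding one_mat_eq_mat1
    by (subst conj_perm_mat, erule assms(1), rule mat1_cong)
      (simp add: inj_on_eq_iff[OF assms(2)])
  then have "det (transpose_mat ?P * 1\<^sub>m n * ?P) = 1"
    by (simp add: one_mat_eq_mat1 [symmetric])
  then have "det ?P * det ?P = 1"
    using P by (simp add: det_mult[of _ n] det_transpose)
  then show ?thesis
    using P by (simp add: det_mult[of _ n] det_transpose ac_simps)
qed

section \<open>Conjugation by difference matrices\<close>

definition at_enat :: "(nat \<Rightarrow> rat) \<Rightarrow> enat \<Rightarrow> rat" where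
  "at_enat f x = (case x of enat i \<Rightarrow> f i | \<infinity> \<Rightarrow> 0)"

lemma at_enat_simps [simp]: "at_enat f (enat i) = f i" "at_enat f \<infinity> = 0"
  by (simp_all add: at_enat_def)

text \<open>A finite \<open>x\<close> selects one summand. For \<open>\<infinity>\<close> every
  indicator vanishes, and the default 0 of \<open>at_enat\<close> mirrors the convention that the
  basis vector at infinity is zero.\<close>

lemma sum_of_bool_enat:
  assumes "\<And>i. x = enat i \<Longrightarrow> i \<in> {1..n}"
  shows "(\<Sum>l\<in>{1..n}. of_bool (enat l = x) * f l) = at_enat f x"
  using assms
  by (cases x) (auto simp: of_bool_def if_distrib if_distribR sum.delta cong: if_cong)

text \<open>The factor \<open>transpose_mat E\<close> subtracts row \<open>s j\<close> from row
  \<open>j\<close>, and \<open>E\<close> does the same to columns; \<open>at_enat\<close> drops the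
  terms at infinity.\<close>

lemma conj_difference_mat:
  fixes s :: "nat \<Rightarrow> enat"
  assumes "\<And>j i. j \<in> {1..n} \<Longrightarrow> s j = enat i \<Longrightarrow> i \<in> {1..n}"
  defines "E \<equiv> mat1 n (\<lambda>j k. of_bool (j = k) - of_bool (enat j = s k))"
  shows "transpose_mat E * mat1 n f * E =
    mat1 n (\<lambda>j k. f j k - at_enat (\<lambda>x. f x k) (s j)
      - at_enat (\<lambda>y. f j y - at_enat (\<lambda>x. f x y) (s j)) (s k))"
proof -
  have diff: "(\<Sum>l\<in>{1..n}. (of_bool (l = j) - of_bool (enat l = s j)) * g l) = g j - at_enat g (s j)"
    if "j \<in> {1..n}" for j and g :: "nat \<Rightarrow> rat"
  proof -
    have "(\<Sum>l\<in>{1..n}. of_bool (l = j) * g l) = g j"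
      using sum_of_bool_enat[of "enat j" n g] that by simp
    then show ?thesis
      using sum_of_bool_enat[of "s j" n g] assms(1)[OF that]
      by (simp add: left_diff_distrib sum_subtractf)
  qed
  show ?thesis
    unfolding E_def transpose_mat1 mult_mat1
  proof (rule mat1_cong)
    fix j k assume jk: "j \<in> {1..n}" "k \<in> {1..n}"
    show "(\<Sum>l\<in>{1..n}. (\<Sum>x\<in>{1..n}. (of_bool (x = j) - of_bool (enat x = s j)) * f x l) *
            (of_bool (l = k) - of_bool (enat l = s k))) =
      f j k - at_enat (\<lambda>x. f x k) (s j)
        - at_enat (\<lambda>y. f j y - at_enat (\<lambda>x. f x y) (s j)) (s k)"
      \<comment> \<open>For a fixed column the inner sum is a row difference; \<open>diff\<close>
        applies again to that difference as a function of the column.\<close>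
      using diff[OF jk(2), of "\<lambda>y. f j y - at_enat (\<lambda>x. f x y) (s j)"]
      by (simp only: diff[OF jk(1)] mult.commute[of _ "of_bool (_ = k) - _"])
  qed
qed

section \<open>Next occurrences\<close>

lemma next_occ_enatD:
  assumes "next_occ n f j = enat k"
  shows "j < k" "k \<le> n" "f k = f j" "\<And>l. j < l \<Longrightarrow> l < k \<Longrightarrow> f l \<noteq> f j"
proof -
  let ?S = "{j' \<in> {j + 1..n}. f j' = f j}"
  have ne: "?S \<noteq> {}" and k: "k = Min ?S"
    using assms by (auto simp: next_occ_def Let_def split: if_splits)
  have "k \<in> ?S"
    unfolding k by (rule Min_in) (use ne in auto)
  then show "j < k" "k \<le> n" "f k = f j" by auto
  show "f l \<noteq> f j" if "j < l" "l < k" for l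
  proof
    assume "f l = f j"
    then have "l \<in> ?S" using that \<open>k \<le> n\<close> by auto
    then have "k \<le> l" unfolding k by (intro Min_le) auto
    then show False using that by simp
  qed
qed

lemma next_occ_gt: "enat j < next_occ n f j"
  by (cases "next_occ n f j") (auto dest: next_occ_enatD)

text \<open>If \<open>j < k\<close>, then \<open>k\<close> would carry the common letter and lie
  strictly between \<open>j\<close> and \<open>l\<close>, against the minimality of
  \<open>l\<close>.\<close>

lemma next_occ_inj:
  assumes "next_occ n f j = enat l" "next_occ n f k = enat l"
  shows "j = k"
  using next_occ_enatD[OF assms(1)] next_occ_enatD[OF assms(2)]
  by (metis linorder_neqE_nat)

lemma next_occ_cong:
  assumes "\<And>j. j \<in> {1..n} \<Longrightarrow> f j = g j" and "j \<in> {1..n}"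
  shows "next_occ n f j = next_occ n g j"
proof -
  have "{j' \<in> {j + 1..n}. f j' = f j} = {j' \<in> {j + 1..n}. g j' = g j}"
    using assms by auto
  then show ?thesis by (simp add: next_occ_def)
qed

section \<open>The matrix of next occurrences\<close>

lemma E_mat_eq_mat1:
  "E_mat w = mat1 (length w) (\<lambda>j k. of_bool (j = k) - of_bool (enat j = nxt w k))"
  unfolding E_mat_def by (rule cols1_difference_eq_mat1)

lemma E_mat_carrier [simp]: "E_mat w \<in> carrier_mat (length w) (length w)"
  by (simp add: E_mat_eq_mat1)

text \<open>Next occurrences lie strictly later, so \<open>E_mat\<close> is lower unitriangular; the
  transpose fits the upper triangular criterion.\<close>

lemma det_E_mat: "det (E_mat w) = 1"
proof -
  have "enat k \<noteq> nxt w j" if "k \<le> j" for j k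
    using next_occ_gt[of j "length w" "\<lambda>j. \<bar>letter w j\<bar>"] that by (auto simp: nxt_def dest: sym)
  then have "det (transpose_mat (E_mat w)) = 1"
    unfolding E_mat_eq_mat1 transpose_mat1
    by (intro det_mat1_upper) auto
  then show ?thesis
    by (simp add: det_transpose[of _ "length w"])
qed

section \<open>The permutation of positions\<close>

lemma index_in_nth:
  assumes "distinct xs" "t < length xs"
  shows "index_in xs (xs ! t) = t + 1"
  unfolding index_in_def
proof (rule the_equality)
  fix u assume "u \<in> {1..length xs} \<and> xs ! (u - 1) = xs ! t"
  moreover from this have "u - 1 < length xs" by auto
  ultimately show "u = t + 1"
    using assms by (auto simp: nth_eq_iff_index_eq)
qed (use assms in auto)

context
  fixes w :: "int list"
  assumes nonzero: "\<And>j. j \<in> {1..length w} \<Longrightarrow> letter w j \<noteq> 0"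
begin

lemma sorted_positions:
  "sorted_wrt (<) (pos_positions w)" "sorted_wrt (<) (neg_positions w)"
  unfolding pos_positions_def neg_positions_def
  by (intro sorted_wrt_filter sorted_wrt_upt)+

lemma length_positions:
  "length (pos_positions w) + length (neg_positions w) = length w"
proof -
  have "neg_positions w = filter (\<lambda>j. \<not> 0 < letter w j) [1..<length w + 1]"
    unfolding neg_positions_def
    by (rule filter_cong[OF refl]) (use nonzero in \<open>fastforce simp: not_less order_less_le\<close>)
  then show ?thesis
    unfolding pos_positions_def
    using sum_length_filter_compl[of "\<lambda>j. 0 < letter w j" "[1..<length w + 1]"]
    by (simp del: upt_Suc)
qed

lemma length_unsigned_word: "length (unsigned_word w) = length w"
  using length_positions by (simp add: unsigned_word_def)

text \<open>Here \<open>t\<close> counts from 0 and \<open>index_in\<close> from 1, which turns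
  \<open>m + 1 - index_in a j\<close> into \<open>m - t\<close>.\<close>

lemma pos_position_cases:
  assumes "j \<in> {1..length w}" "0 < letter w j"
  obtains t where "t < length (pos_positions w)" "pos_positions w ! t = j"
    "tau w j = length (pos_positions w) - t"
proof -
  have mem: "j \<in> set (pos_positions w)"
    using assms by (auto simp: pos_positions_def simp del: upt_Suc)
  then obtain t where t: "t < length (pos_positions w)" "pos_positions w ! t = j"
    by (auto simp: in_set_conv_nth)
  have "index_in (pos_positions w) j = t + 1"
    using index_in_nth[of "pos_positions w" t] t by (simp add: pos_positions_def)
  then show thesis
    using mem t by (intro that[of t]) (simp_all add: tau_def Let_def)
qed

lemma neg_position_cases:
  assumes "j \<in> {1..length w}" "letter w j < 0"
  obtains t where "t < length (neg_positions w)" "neg_positions w ! t = j"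
    "tau w j = length (pos_positions w) + t + 1"
proof -
  have mem: "j \<in> set (neg_positions w)" "j \<notin> set (pos_positions w)"
    using assms by (auto simp: neg_positions_def pos_positions_def simp del: upt_Suc)
  then obtain t where t: "t < length (neg_positions w)" "neg_positions w ! t = j"
    by (auto simp: in_set_conv_nth)
  have "index_in (neg_positions w) j = t + 1"
    using index_in_nth[of "neg_positions w" t] t by (simp add: neg_positions_def)
  then show thesis
    using mem t by (intro that[of t]) (simp_all add: tau_def Let_def)
qed

lemma tau_range:
  assumes "j \<in> {1..length w}"
  shows "tau w j \<in> {1..length w}"
proof (cases "0 < letter w j")
  case True
  then show ?thesis
    using pos_position_cases[OF assms] length_positions by fastforce
next
  case False
  with nonzero[OF assms] have "letter w j < 0" by simp
  then show ?thesis
    using neg_position_cases[OF assms] length_positions by fastforce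
qed

text \<open>With m positive positions, a positive \<open>j\<close> leads to list index
  \<open>m - t - 1\<close>, which \<open>rev\<close> sends back to entry \<open>t\<close>; a
  negative \<open>j\<close> leads to index \<open>m + t\<close>, entry \<open>t\<close> of the
  second block.\<close>

lemma letter_unsigned_word_tau:
  assumes "j \<in> {1..length w}"
  shows "letter (unsigned_word w) (tau w j) = \<bar>letter w j\<bar>"
proof (cases "0 < letter w j")
  case True
  then obtain t where t: "t < length (pos_positions w)" "pos_positions w ! t = j"
    "tau w j = length (pos_positions w) - t"
    using pos_position_cases[OF assms] by blast
  then show ?thesis
    using True
    by (auto simp: unsigned_word_def letter_def[of "_ @ _"] nth_append rev_nth)
next
  case False
  with nonzero[OF assms] have "letter w j < 0" by simp
  moreover from this obtain t where t: "t < length (neg_positions w)" "neg_positions w ! t = j"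
    "tau w j = length (pos_positions w) + t + 1"
    using neg_position_cases[OF assms] by blast
  ultimately show ?thesis
    by (simp add: unsigned_word_def letter_def[of "_ @ _"] nth_append)
qed

text \<open>\<open>tau\<close> sends the positive positions, in reverse order, before all negative
  ones, which keep their order. These are the three clauses of \<open>P_set\<close>.\<close>

lemma tau_less_iff:
  assumes j: "j \<in> {1..length w}" and k: "k \<in> {1..length w}"
  shows "tau w j < tau w k \<longleftrightarrow> (j, k) \<in> P_set w"
proof -
  have mono: "xs ! t < xs ! u \<longleftrightarrow> t < u"
    if "sorted_wrt (<) xs" "t < length xs" "u < length xs" for xs :: "nat list" and t u
    using that sorted_wrt_nth_less[OF that(1)]
    by (metis linorder_neqE_nat order_less_asym order_less_irrefl)
  note mono_pos = mono[OF sorted_positions(1)] and mono_neg = mono[OF sorted_positions(2)]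
  consider "0 < letter w j" "0 < letter w k" | "0 < letter w j" "letter w k < 0"
    | "letter w j < 0" "0 < letter w k" | "letter w j < 0" "letter w k < 0"
    using nonzero[OF j] nonzero[OF k] by linarith
  then show ?thesis
  proof cases
    case 1
    from pos_position_cases[OF j 1(1)] obtain t where t: "t < length (pos_positions w)"
      "pos_positions w ! t = j" "tau w j = length (pos_positions w) - t" .
    from pos_position_cases[OF k 1(2)] obtain u where u: "u < length (pos_positions w)"
      "pos_positions w ! u = k" "tau w k = length (pos_positions w) - u" .
    show ?thesis
      using mono_pos[of u t] t u 1 j k by (auto simp: P_set_def eps_def)
  next
    case 2
    from pos_position_cases[OF j 2(1)] obtain t where t:
      "tau w j = length (pos_positions w) - t" .
    from neg_position_cases[OF k 2(2)] obtain u where u: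
      "tau w k = length (pos_positions w) + u + 1" .
    show ?thesis
      using t u 2 j k by (auto simp: P_set_def eps_def)
  next
    case 3
    from neg_position_cases[OF j 3(1)] obtain t where t:
      "tau w j = length (pos_positions w) + t + 1" .
    from pos_position_cases[OF k 3(2)] obtain u where u:
      "tau w k = length (pos_positions w) - u" .
    show ?thesis
      using t u 3 j k by (auto simp: P_set_def eps_def)
  next
    case 4
    from neg_position_cases[OF j 4(1)] obtain t where t: "t < length (neg_positions w)"
      "neg_positions w ! t = j" "tau w j = length (pos_positions w) + t + 1" .
    from neg_position_cases[OF k 4(2)] obtain u where u: "u < length (neg_positions w)"
      "neg_positions w ! u = k" "tau w k = length (pos_positions w) + u + 1" .
    show ?thesis
      using mono_neg[of t u] t u 4 j k by (auto simp: P_set_def eps_def)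
  qed
qed

lemma eps_cases:
  assumes "j \<in> {1..length w}"
  shows "eps w j = 1 \<or> eps w j = -1"
  using nonzero[OF assms] by (auto simp: eps_def sgn_if)

text \<open>Of two distinct positions, one order or the other always belongs to
  \<open>P_set\<close>, so their images are strictly comparable.\<close>

lemma inj_on_tau: "inj_on (tau w) {1..length w}"
proof (rule inj_onI)
  fix j k assume jk: "j \<in> {1..length w}" "k \<in> {1..length w}" "tau w j = tau w k"
  then have "(j, k) \<notin> P_set w" "(k, j) \<notin> P_set w"
    using tau_less_iff[OF jk(1,2)] tau_less_iff[OF jk(2,1)] by auto
  then show "j = k"
    using jk(1,2) eps_cases[OF jk(1)] eps_cases[OF jk(2)] by (auto simp: P_set_def)
qed

section \<open>Reduction of \<open>M_hat\<close> to \<open>E_mat\<close> and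
  \<open>Q_mat\<close>\<close>

lemma E_tau_eq_E_mat: "E_tau w = E_mat w"
proof -
  have "s_tau w j = nxt w j" if "j \<in> {1..length w}" for j
    unfolding s_tau_def nxt_def by (rule next_occ_cong[OF letter_unsigned_word_tau that])
  then show ?thesis
    unfolding E_mat_eq_mat1 E_tau_def cols1_difference_eq_mat1
    by (intro mat1_cong) auto
qed

lemma conj_Q_upper:
  "transpose_mat (perm_mat (length w) (tau w)) * Q_upper A (unsigned_word w)
    * perm_mat (length w) (tau w) = Q_mat A w"
  unfolding Q_upper_def length_unsigned_word Q_mat_def
  by (subst conj_perm_mat, erule tau_range, rule mat1_cong)
    (simp add: tau_less_iff letter_unsigned_word_tau inj_on_eq_iff[OF inj_on_tau])

lemma M_hat_eq: "M_hat A w = transpose_mat (E_mat w) * Q_mat A w * E_mat w"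
proof -
  let ?n = "length w"
  let ?P = "perm_mat ?n (tau w)" and ?E = "E_mat w" and ?Q = "Q_upper A (unsigned_word w)"
  have c: "?P \<in> carrier_mat ?n ?n" "?E \<in> carrier_mat ?n ?n" "?Q \<in> carrier_mat ?n ?n"
    by (simp_all add: perm_mat_eq_mat1 Q_upper_def length_unsigned_word)
  have "M_hat A w = (transpose_mat ?E * transpose_mat ?P) * ?Q * (?P * ?E)"
    using c by (simp add: M_hat_def Let_def E_tau_eq_E_mat transpose_mult[of _ ?n ?n _ ?n])
  also have "\<dots> = transpose_mat ?E * (transpose_mat ?P * ?Q * ?P) * ?E"
    using c by (simp add: assoc_mult_mat[of _ ?n ?n _ ?n _ ?n] mult_carrier_mat[of _ ?n ?n])
  finally show ?thesis by (simp add: conj_Q_upper)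
qed

text \<open>\<open>Q_mat\<close> need not be triangular in the given order of positions, but it is a
  permutation conjugate of the unitriangular \<open>Q_upper\<close>.\<close>

lemma det_Q_mat: "det (Q_mat A w) = 1"
  unfolding conj_Q_upper [symmetric] Q_upper_def length_unsigned_word
  by (subst det_conj_perm_mat) (use tau_range inj_on_tau in \<open>auto intro: det_mat1_upper\<close>)

end

section \<open>The entries of the cluster ensemble matrix\<close>

definition half_sign :: "(nat \<Rightarrow> rat) \<Rightarrow> nat \<Rightarrow> nat \<Rightarrow> rat" where
  "half_sign e x y = (1 + of_bool (y < x) * e x - of_bool (x < y) * e y) / 2"

text \<open>For distinct positions the sign of the later one alone decides membership in
  \<open>P_set\<close>: it must be 1 if that is \<open>x\<close> and -1 if it is
  \<open>y\<close>.\<close>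

lemma Q_mat_entry:
  fixes w :: "int list"
  assumes nonzero: "\<And>j. j \<in> {1..length w} \<Longrightarrow> letter w j \<noteq> 0"
    and x: "x \<in> {1..length w}" and y: "y \<in> {1..length w}"
    and diag: "x = y \<Longrightarrow> cartan A \<bar>letter w x\<bar> \<bar>letter w x\<bar> = 2"
  shows "(if x = y then 1
      else if (x, y) \<in> P_set w then cartan A \<bar>letter w x\<bar> \<bar>letter w y\<bar> else 0) =
    cartan A \<bar>letter w x\<bar> \<bar>letter w y\<bar> * half_sign (eps w) x y"
  using x y diag eps_cases[OF nonzero x] eps_cases[OF nonzero y]
  by (auto simp: P_set_def half_sign_def)

text \<open>The constant 1/2 in \<open>half_sign\<close> cancels from the mixed difference unless
  both \<open>j1\<close> and \<open>k1\<close> are infinite, whence the first indicator; the others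
  collect the signs. The assumptions abstract what holds for next occurrences, and
  \<open>- e\<close> stands for \<open>eta\<close>.\<close>

lemma half_sign_mixed_difference:
  fixes j k :: nat and j1 k1 :: enat and e :: "nat \<Rightarrow> rat"
  assumes "enat j < j1" "enat k < k1"
    and "\<And>l. j1 = enat l \<Longrightarrow> k1 = enat l \<Longrightarrow> j = k" and "j = k \<Longrightarrow> j1 = k1"
  shows "half_sign e j k - at_enat (\<lambda>x. half_sign e x k) j1
      - at_enat (\<lambda>y. half_sign e j y - at_enat (\<lambda>x. half_sign e x y) j1) k1 =
    1 / 2 * (of_bool (j1 = \<infinity> \<and> k1 = \<infinity>)
      + (- e k) * of_bool (j1 = enat k)
      - (- e j) * of_bool (k1 = enat j)
      + (- e k) * of_bool (j < k \<and> enat k < j1)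
      - (- e (the_enat k1)) * of_bool (enat j < k1 \<and> k1 < j1) * of_bool (k1 < \<infinity>)
      - (- e j) * of_bool (k < j \<and> enat j < k1)
      + (- e (the_enat j1)) * of_bool (enat k < j1 \<and> j1 < k1) * of_bool (j1 < \<infinity>))"
proof (cases j1)
  case (enat a)
  show ?thesis
  proof (cases k1)
    case (enat b)
    have "j < a" "k < b" "a = b \<longleftrightarrow> j = k"
      using assms \<open>j1 = enat a\<close> \<open>k1 = enat b\<close> by auto
    then show ?thesis
      unfolding \<open>j1 = enat a\<close> \<open>k1 = enat b\<close>
      \<comment> \<open>With \<open>j < a\<close> and \<open>k < b\<close>, these four comparisons
        settle every indicator on both sides.\<close>
      by (cases j k rule: linorder_cases; cases j b rule: linorder_cases;
          cases a k rule: linorder_cases; cases a b rule: linorder_cases)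
        (simp_all add: half_sign_def diff_divide_distrib add_divide_distrib)
  next
    case infinity
    have "j < a" "j \<noteq> k"
      using assms \<open>j1 = enat a\<close> \<open>k1 = \<infinity>\<close> by auto
    then show ?thesis
      unfolding \<open>j1 = enat a\<close> \<open>k1 = \<infinity>\<close>
      by (cases j k rule: linorder_cases; cases a k rule: linorder_cases)
        (simp_all add: half_sign_def diff_divide_distrib add_divide_distrib)
  qed
next
  case infinity
  show ?thesis
  proof (cases k1)
    case (enat b)
    have "k < b" "j \<noteq> k"
      using assms \<open>j1 = \<infinity>\<close> \<open>k1 = enat b\<close> by auto
    then show ?thesis
      unfolding \<open>j1 = \<infinity>\<close> \<open>k1 = enat b\<close>
      by (cases j k rule: linorder_cases; cases j b rule: linorder_cases)
        (simp_all add: half_sign_def diff_divide_distrib add_divide_distrib)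
  next
    case infinity
    show ?thesis
      unfolding \<open>j1 = \<infinity>\<close> \<open>k1 = \<infinity>\<close>
      by (cases j k rule: linorder_cases) (simp_all add: half_sign_def)
  qed
qed

lemma B_hat_eq:
  assumes nonzero: "\<And>j. j \<in> {1..length w} \<Longrightarrow> letter w j \<noteq> 0"
    and diag: "\<And>j. j \<in> {1..length w} \<Longrightarrow> cartan A \<bar>letter w j\<bar> \<bar>letter w j\<bar> = 2"
  shows "B_hat A w = transpose_mat (E_mat w) * Q_mat A w * E_mat w"
proof -
  let ?n = "length w"
  let ?c = "\<lambda>j k. cartan A \<bar>letter w j\<bar> \<bar>letter w k\<bar>"
  let ?h = "half_sign (eps w)"
  have range: "i \<in> {1..?n}" and same: "\<bar>letter w i\<bar> = \<bar>letter w j\<bar>"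
    if "nxt w j = enat i" for i j
    using next_occ_enatD[OF that[unfolded nxt_def]] by auto
  have Q: "Q_mat A w = mat1 ?n (\<lambda>j k. ?c j k * ?h j k)"
    unfolding Q_mat_def by (rule mat1_cong) (rule Q_mat_entry[OF nonzero _ _ diag])
  show ?thesis
    unfolding Q E_mat_eq_mat1 B_hat_def
  proof (subst conj_difference_mat, erule range, rule mat1_cong)
    fix j k assume "j \<in> {1..?n}" "k \<in> {1..?n}"
    \<comment> \<open>Passing to a next occurrence preserves the absolute letter, so all four terms
      share one Cartan integer.\<close>
    have "?c j k * ?h j k - at_enat (\<lambda>x. ?c x k * ?h x k) (nxt w j)
        - at_enat (\<lambda>y. ?c j y * ?h j y - at_enat (\<lambda>x. ?c x y * ?h x y) (nxt w j)) (nxt w k) =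
      ?c j k * (?h j k - at_enat (\<lambda>x. ?h x k) (nxt w j)
        - at_enat (\<lambda>y. ?h j y - at_enat (\<lambda>x. ?h x y) (nxt w j)) (nxt w k))"
      by (cases "nxt w j"; cases "nxt w k") (simp_all add: same algebra_simps)
    also note half_sign_mixed_difference
    finally show "1 / 2 * ?c j k *
      (of_bool (nxt w j = \<infinity> \<and> nxt w k = \<infinity>)
        + eta w k * of_bool (nxt w j = enat k)
        - eta w j * of_bool (nxt w k = enat j)
        + eta w k * of_bool (j < k \<and> enat k < nxt w j)
        - eta w (the_enat (nxt w k)) *
            of_bool (enat j < nxt w k \<and> nxt w k < nxt w j) * of_bool (nxt w k < \<infinity>)
        - eta w j * of_bool (k < j \<and> enat j < nxt w k)
        + eta w (the_enat (nxt w j)) *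
            of_bool (enat k < nxt w j \<and> nxt w j < nxt w k) * of_bool (nxt w j < \<infinity>)) =
      ?c j k * ?h j k - at_enat (\<lambda>x. ?c x k * ?h x k) (nxt w j)
        - at_enat (\<lambda>y. ?c j y * ?h j y - at_enat (\<lambda>x. ?c x y * ?h x y) (nxt w j)) (nxt w k)"
      by (simp add: nxt_def next_occ_gt next_occ_inj[of ?n _ j _ k] eta_def)
  qed
qed

theorem theorem5p5p1:
  fixes r :: nat and A :: "int mat" and w :: "int list"
  assumes "generalized_cartan r A" and "symmetrizable r A"
    and "signed_word r w"
  shows "B_hat A w = M_hat A w \<and>
         M_hat A w = transpose_mat (E_mat w) * Q_mat A w * E_mat w \<and>
         det (B_hat A w) = 1"
proof -
  let ?n = "length w"
  have letter: "letter w j \<in> {- int r..-1} \<union> {1..int r}" if "j \<in> {1..?n}" for j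
  proof -
    have "letter w j \<in> set w"
      using that unfolding letter_def by (intro nth_mem) auto
    then show ?thesis
      using assms(3) by (auto simp: signed_word_def)
  qed
  have nonzero: "letter w j \<noteq> 0" if "j \<in> {1..?n}" for j
    using letter[OF that] by auto
  have diag: "cartan A \<bar>letter w j\<bar> \<bar>letter w j\<bar> = 2" if "j \<in> {1..?n}" for j
  proof -
    have "nat \<bar>letter w j\<bar> \<in> {1..r}"
      using letter[OF that] by auto
    then show ?thesis
      using assms(1) by (simp add: cartan_def generalized_cartan_def)
  qed
  have B: "B_hat A w = transpose_mat (E_mat w) * Q_mat A w * E_mat w"
    by (rule B_hat_eq[OF nonzero diag])
  have "Q_mat A w \<in> carrier_mat ?n ?n"
    by (simp add: Q_mat_def)
  moreover have "det (Q_mat A w) = 1"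
    by (rule det_Q_mat[OF nonzero])
  \<comment> \<open>The determinant is that of \<open>Q_mat\<close> times the square of that of
    \<open>E_mat\<close>.\<close>
  ultimately have "det (transpose_mat (E_mat w) * Q_mat A w * E_mat w) = 1"
    using E_mat_carrier[of w]
    by (simp add: det_mult[of _ ?n] mult_carrier_mat[of _ ?n ?n] det_transpose[of _ ?n]
        det_E_mat)
  then show ?thesis
    using B M_hat_eq[OF nonzero] by simp
qed

end
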